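(* Let $\mathbb{F}_q$ be a finite field, let $f\in\mathbb{F}_q[x]$ be a nonzero monic polynomial, and let $D=\{f_1,f_2,\ldots,f_k\}$ ($k\ge 1$) be a set of monic divisors of $f$ with $f\notin D$. Suppose that either $\mathbb{F}_q\neq\mathbb{F}_2$ or $\gcd(x(x+1),f)=1$. Then the gcd-graph $G_f(D)$ is not bipartite.
   Context: All polynomials are monic unless stated otherwise and gcd's are taken monic (so $\gcd(0,f)=f$). For a nonzero monic $f\in\mathbb{F}_q[x]$ and a set $D$ of monic divisors of $f$ with $f\notin D$, the gcd-graph $G_f(D)$ is the undirected loopless graph with vertex set the ring $\mathbb{F}_q[x]/(f)$ in which two vertices $u,v$ are adjacent if and only if $\gcd(u-v,f)\in D$. *)

theory Defs
  imports
    "HOL-Computational_Algebra.Polynomial_Factorial"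
    "HOL-Number_Theory.Cong"
    "Graph_Theory.Pair_Digraph"
begin

abbreviation monic :: "'a::{zero, one} poly \<Rightarrow> bool" where
  "monic p \<equiv> lead_coeff p = 1"

definition cong_rel :: "'a::field poly \<Rightarrow> 'a poly rel" where
  "cong_rel f = {(p, q). [p = q] (mod f)}"

text \<open>
  The vertices are the elements of the ring of polynomials modulo \<open>f\<close>, as residue classes.
  By \<open>gcd_graph_arc_iff\<close> below, adjacency does not depend on the representatives, and by
  \<open>pair_graph_gcd_graph\<close> the result is a finite simple graph.
\<close>

definition gcd_graph ::
    "'a::field_gcd poly \<Rightarrow> 'a poly set \<Rightarrow> 'a poly set pair_pre_digraph" where
  "gcd_graph f D =
     \<lparr>pverts = UNIV // cong_rel f,
      parcs = {(cong_rel f `` {u}, cong_rel f `` {v}) | u v. gcd (u - v) f \<in> D}\<rparr>"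

definition bipartite :: "('v, 'e) pre_digraph \<Rightarrow> bool" where
  "bipartite G \<longleftrightarrow> (\<exists>U V. verts G = U \<union> V \<and> U \<inter> V = {} \<and>
     arcs_ends G \<subseteq> U \<times> V \<union> V \<times> U)"

text \<open>
  Since the unit factor of a field element is the element itself, \<open>gcd\<close> on polynomials
  over a \<open>field_gcd\<close> is the monic one.
\<close>

lemma unit_factor_field_gcd: "unit_factor (c::'a::field_gcd) = c"
  by (cases "c = 0") (simp_all add: is_unit_unit_factor dvd_field_iff)

lemma monic_gcd:
  fixes p q :: "'a::field_gcd poly"
  assumes "p \<noteq> 0 \<or> q \<noteq> 0"
  shows "monic (gcd p q)"
proof -
  have "gcd p q \<noteq> 0"
    using assms by simp
  moreover have "monic (normalize r)" if "r \<noteq> 0" for r :: "'a poly"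
    using that
    by (simp add: normalize_poly_eq_map_poly unit_factor_field_gcd coeff_map_poly degree_map_poly)
  ultimately show ?thesis
    by (metis normalize_gcd)
qed

lemma gcd_0_monic:
  fixes f :: "'a::field_gcd poly"
  shows "monic f \<Longrightarrow> gcd 0 f = f"
  by (simp add: normalize_poly_eq_map_poly unit_factor_field_gcd)

lemma equiv_cong_rel: "equiv UNIV (cong_rel f)"
  by (auto simp: cong_rel_def cong_def intro!: equivI refl_onI symI transI)

lemma residue_class_eq_iff: "cong_rel f `` {p} = cong_rel f `` {q} \<longleftrightarrow> [p = q] (mod f)"
  using eq_equiv_class_iff[OF equiv_cong_rel, of p q f] by (simp add: cong_rel_def)

lemma gcd_graph_arc_iff:
  "(cong_rel f `` {u}, cong_rel f `` {v}) \<in> parcs (gcd_graph f D) \<longleftrightarrow> gcd (u - v) f \<in> D"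
proof -
  have "gcd (u - v) f = gcd (u' - v') f"
    if "[u = u'] (mod f)" "[v = v'] (mod f)" for u' v'
    using that by (intro cong_gcd_eq cong_diff)
  then show ?thesis
    unfolding gcd_graph_def by (auto simp: residue_class_eq_iff) (metis cong_refl)
qed

lemma finite_residue_classes:
  fixes f :: "'a::{finite, field} poly"
  assumes "f \<noteq> 0"
  shows "finite (UNIV // cong_rel f)"
proof -
  have "finite {p::'a poly. degree p \<le> degree f}"
  proof (rule finite_surj)
    show "finite {xs::'a list. set xs \<subseteq> UNIV \<and> length xs \<le> Suc (degree f)}"
      by (rule finite_lists_length_le) simp
    show "{p. degree p \<le> degree f} \<subseteq>
        Poly ` {xs::'a list. set xs \<subseteq> UNIV \<and> length xs \<le> Suc (degree f)}"
    proof
      fix p :: "'a poly"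
      assume "p \<in> {p. degree p \<le> degree f}"
      then show "p \<in> Poly ` {xs. set xs \<subseteq> UNIV \<and> length xs \<le> Suc (degree f)}"
        by (intro image_eqI[of _ _ "coeffs p"])
          (simp, cases "p = 0", auto simp: length_coeffs_degree)
    qed
  qed
  moreover have "UNIV // cong_rel f \<subseteq>
      (\<lambda>p. cong_rel f `` {p}) ` {p. degree p \<le> degree f}"
  proof
    fix X
    assume "X \<in> UNIV // cong_rel f"
    then obtain p where "X = cong_rel f `` {p}"
      by (auto elim: quotientE)
    then have "X = cong_rel f `` {p mod f}"
      by (simp add: residue_class_eq_iff)
    moreover have "degree (p mod f) \<le> degree f"
      using degree_mod_less[OF assms, of p] by auto
    ultimately show "X \<in> (\<lambda>p. cong_rel f `` {p}) ` {p. degree p \<le> degree f}"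
      by auto
  qed
  ultimately show ?thesis
    by (meson finite_imageI finite_subset)
qed

lemma pair_graph_gcd_graph:
  fixes f :: "'a::{finite, field_gcd} poly"
  assumes "f \<noteq> 0" and "monic f" and "f \<notin> D"
  shows "pair_graph (gcd_graph f D)"
proof -
  let ?G = "gcd_graph f D"
  have verts: "finite (pverts ?G)"
    using finite_residue_classes[OF \<open>f \<noteq> 0\<close>] by (simp add: gcd_graph_def)
  have sub: "parcs ?G \<subseteq> pverts ?G \<times> pverts ?G"
    by (auto simp: gcd_graph_def quotient_def)
  have "sym (parcs ?G)"
  proof (rule symI)
    fix X Y
    assume "(X, Y) \<in> parcs ?G"
    then obtain u v where "X = cong_rel f `` {u}" "Y = cong_rel f `` {v}"
      and "gcd (u - v) f \<in> D"
      by (auto simp: gcd_graph_def)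
    moreover have "gcd (v - u) f = gcd (u - v) f"
      using gcd_neg1[of "u - v" f] by simp
    ultimately show "(Y, X) \<in> parcs ?G"
      by (simp add: gcd_graph_arc_iff)
  qed
  moreover have "fst e \<noteq> snd e" if e: "e \<in> parcs ?G" for e
  proof
    assume eq: "fst e = snd e"
    obtain u where "fst e = cong_rel f `` {u}"
      using e by (auto simp: gcd_graph_def)
    then have "gcd (u - u) f \<in> D"
      using e eq by (metis gcd_graph_arc_iff prod.collapse)
    then show False
      using assms gcd_0_monic[of f] by (metis diff_self)
  qed
  ultimately show ?thesis
    using sub verts finite_subset[OF sub] by unfold_locales (auto simp: symmetric_def)
qed

end

theory Submission
  imports Defs
begin

text \<open>
  The graph contains a triangle. For \<open>g \<in> D\<close> with \<open>f = g h\<close>, two residues that differ by \<open>g w\<close>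
  are adjacent as soon as \<open>w\<close> is coprime to \<open>h\<close>, because then \<open>gcd (g w) (g h) = g\<close>. So it is
  enough to find a polynomial \<open>s\<close> such that both \<open>s\<close> and \<open>s + 1\<close> are coprime to \<open>h\<close>: the residues
  of \<open>0\<close>, \<open>g s\<close> and \<open>g (s + 1)\<close> then differ pairwise by \<open>g s\<close>, \<open>g (s + 1)\<close> and \<open>g\<close>, up to sign.
  If the field has an element other than \<open>0\<close> and \<open>-1\<close>, that constant serves as \<open>s\<close>; over the field
  with two elements, where no such constant exists, the hypothesis on \<open>x (x + 1)\<close> lets \<open>x\<close> serve.
\<close>

lemma triangle_imp_not_bipartite:
  assumes "(x, y) \<in> arcs_ends G" "(y, z) \<in> arcs_ends G" "(z, x) \<in> arcs_ends G"
  shows "\<not> bipartite G"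
  using assms unfolding bipartite_def by blast

lemma gcd_mult_cofactor_coprime:
  fixes g h w :: "'a::field_gcd poly"
  assumes "monic g" and "coprime w h"
  shows "gcd (g * w) (g * h) = g"
proof -
  have "normalize g = g"
    using assms(1) gcd_0_monic[of g] by simp
  then show ?thesis
    using assms(2) by (simp add: gcd_mult_left coprime_iff_gcd_eq_1)
qed

lemma gcd_graph_not_bipartite_if_consecutive_units:
  fixes g h s :: "'a::field_gcd poly"
  assumes g: "g \<in> D" "monic g" and s: "coprime s h" "coprime (s + 1) h"
  shows "\<not> bipartite (with_proj (gcd_graph (g * h) D))"
proof -
  let ?c = "\<lambda>p. cong_rel (g * h) `` {p}"
  have arc: "(?c u, ?c v) \<in> arcs_ends (with_proj (gcd_graph (g * h) D))"
    if "u - v = g * w" "coprime w h" for u v w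
    using that g gcd_mult_cofactor_coprime[of g w h]
    by (simp add: gcd_graph_arc_iff arcs_ends_def arc_to_ends_def)
  show ?thesis
  proof (rule triangle_imp_not_bipartite)
    show "(?c 0, ?c (g * s)) \<in> arcs_ends (with_proj (gcd_graph (g * h) D))"
      by (rule arc[of _ _ "- s"]) (use s in simp_all)
    show "(?c (g * s), ?c (g * (s + 1))) \<in> arcs_ends (with_proj (gcd_graph (g * h) D))"
      by (rule arc[of _ _ "- 1"]) (simp_all add: algebra_simps)
    show "(?c (g * (s + 1)), ?c 0) \<in> arcs_ends (with_proj (gcd_graph (g * h) D))"
      by (rule arc[of _ _ "s + 1"]) (use s in simp_all)
  qed
qed

lemma ex_field_element_not_0_minus_1:
  assumes "card (UNIV :: 'a set) \<noteq> 2"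
  obtains a :: "'a::field" where "a \<noteq> 0" "a + 1 \<noteq> 0"
proof -
  have "card {0, - 1 :: 'a} = 2"
    by simp
  then have "(UNIV :: 'a set) \<noteq> {0, - 1}"
    using assms by metis
  then obtain a :: 'a where "a \<noteq> 0" "a \<noteq> - 1"
    by blast
  then show ?thesis
    using that by (simp add: add_eq_0_iff2)
qed

theorem corollary4p2:
  fixes f :: "'a::{finite, field_gcd} poly"
    and D :: "'a poly set"
  assumes "f \<noteq> 0" and "monic f"
    and "finite D" and "D \<noteq> {}"
    and "\<And>g. g \<in> D \<Longrightarrow> monic g \<and> g dvd f"
    and "f \<notin> D"
    and "card (UNIV :: 'a set) \<noteq> 2 \<or> gcd ([:0, 1:] * [:1, 1:]) f = 1"
  shows "\<not> bipartite (with_proj (gcd_graph f D))"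
proof -
  obtain g where g: "g \<in> D"
    using \<open>D \<noteq> {}\<close> by blast
  then obtain h where f: "f = g * h"
    using assms(5) by blast
  obtain s where "coprime s h" "coprime (s + 1) h"
    using assms(7)
  proof
    assume "card (UNIV :: 'a set) \<noteq> 2"
    then obtain a :: 'a where "a \<noteq> 0" "a + 1 \<noteq> 0"
      by (rule ex_field_element_not_0_minus_1)
    then have "is_unit [:a:]" "is_unit ([:a:] + 1)"
      by (simp_all add: is_unit_const_poly_iff dvd_field_iff one_pCons)
    then show thesis
      using that is_unit_left_imp_coprime by blast
  next
    assume "gcd ([:0, 1:] * [:1, 1:]) f = 1"
    then have "coprime ([:0, 1:] * [:1, 1:]) (g * h)"
      unfolding f by (simp only: coprime_iff_gcd_eq_1)
    then have "coprime [:0, 1:] h" "coprime ([:0, 1:] + 1) h"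
      by (simp_all only: coprime_mult_left_iff coprime_mult_right_iff one_pCons add_pCons
          add_0_left add_0_right)
    then show thesis
      using that by blast
  qed
  then show ?thesis
    using gcd_graph_not_bipartite_if_consecutive_units g assms(5) unfolding f by blast
qed

end
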